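(* Let $k\geq 3$ and suppose there exists a Steiner system $S(k-1,k,n)$ on the point set $[n]$ with $n\geq 4k-2$. Then its blocks form a resolving set for the Kneser graph $K(n,k)$, and consequently \[ \beta(K(n,k))\leq \frac{1}{k}\binom{n}{k-1}. \]
   Context: For integers $n>k>t>1$, a Steiner system $S(t,k,n)$ is a family of $k$-subsets (blocks) of $[n]=\{1,\dots,n\}$ such that every $t$-subset of $[n]$ is contained in exactly one block. The Kneser graph $K(n,k)$ has as vertices the $k$-subsets of $[n]$, adjacent when disjoint. A resolving set is a set $\mathcal{S}$ of vertices such that for all distinct vertices $U,W$ some $X\in\mathcal{S}$ has $d(U,X)\neq d(W,X)$; $\beta$ is the minimum size of a resolving set. *)

theory Defs
  imports Complex_Main "Graph_Theory.Graph_Theory"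
begin

definition k_subsets :: "nat \<Rightarrow> nat \<Rightarrow> nat set set" where
  "k_subsets n k = {A. A \<subseteq> {1..n} \<and> card A = k}"

definition steiner_system :: "nat \<Rightarrow> nat \<Rightarrow> nat \<Rightarrow> nat set set \<Rightarrow> bool" where
  "steiner_system t k n \<B> \<longleftrightarrow>
     1 < t \<and> t < k \<and> k < n \<and> \<B> \<subseteq> k_subsets n k \<and>
     (\<forall>T \<in> k_subsets n t. \<exists>!B \<in> \<B>. T \<subseteq> B)"

text \<open>Following the convention of \<^theory>\<open>Graph_Theory.Digraph\<close>, an undirected graph is a
  symmetric digraph. The arc relation is irreflexive for \<open>k \<ge> 1\<close> only (the empty set is disjoint
  from itself).\<close>

definition kneser_graph :: "nat \<Rightarrow> nat \<Rightarrow> nat set pair_pre_digraph" where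
  "kneser_graph n k =
     \<lparr> pverts = k_subsets n k,
       parcs = {(A, B). A \<in> k_subsets n k \<and> B \<in> k_subsets n k \<and> A \<inter> B = {}} \<rparr>"

lemma finite_k_subsets: "finite (k_subsets n k)"
proof -
  have "k_subsets n k \<subseteq> Pow {1..n}"
    unfolding k_subsets_def by blast
  then show ?thesis
    by (rule finite_subset) simp
qed

lemma kneser_graph_irrefl:
  assumes "k \<ge> 1"
  shows "(A, A) \<notin> parcs (kneser_graph n k)"
proof
  assume "(A, A) \<in> parcs (kneser_graph n k)"
  then have "A = {}" and "A \<in> k_subsets n k"
    unfolding kneser_graph_def by auto
  then have "k = 0"
    unfolding k_subsets_def by simp
  with assms show False by simp
qed

lemma pair_graph_kneser_graph:
  assumes "k \<ge> 1"
  shows "pair_graph (kneser_graph n k)"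
proof -
  have sub: "parcs (kneser_graph n k) \<subseteq> k_subsets n k \<times> k_subsets n k"
    unfolding kneser_graph_def by auto
  have verts: "pverts (kneser_graph n k) = k_subsets n k"
    unfolding kneser_graph_def by simp
  have fin: "finite (parcs (kneser_graph n k))"
    using sub by (rule finite_subset) (simp add: finite_k_subsets)
  have sym: "symmetric (with_proj (kneser_graph n k))"
    by (auto simp: kneser_graph_def symmetric_def sym_def)
  have irrefl: "fst e \<noteq> snd e" if "e \<in> parcs (kneser_graph n k)" for e
    using that kneser_graph_irrefl[OF assms, of "fst e" n] by (metis prod.collapse)
  show ?thesis
  proof (unfold_locales, goal_cases)
    case (1 e) with sub verts show ?case by (metis mem_Times_iff subsetD)
  next
    case (2 e) with sub verts show ?case by (metis mem_Times_iff subsetD)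
  next
    case 3 show ?case by (simp only: verts finite_k_subsets)
  next
    case 4 show ?case by (rule fin)
  next
    case (5 e) then show ?case by (rule irrefl)
  next
    case 6 show ?case by (rule sym)
  qed
qed

text \<open>With unit weights, \<^const>\<open>wf_digraph.\<mu>\<close> is the least number of arcs on a walk from \<open>u\<close> to
  \<open>v\<close>, and \<open>\<infinity>\<close> if there is no such walk. It is only meaningful for well-formed \<open>G\<close>, a
  requirement that the definitions below inherit.\<close>

definition graph_dist :: "('a, 'b) pre_digraph \<Rightarrow> 'a \<Rightarrow> 'a \<Rightarrow> ereal" where
  "graph_dist G u v = wf_digraph.\<mu> G (\<lambda>_. 1) u v"

definition resolving_set :: "('a, 'b) pre_digraph \<Rightarrow> 'a set \<Rightarrow> bool" where
  "resolving_set G S \<longleftrightarrow>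
     S \<subseteq> verts G \<and>
     (\<forall>u \<in> verts G. \<forall>w \<in> verts G. u \<noteq> w \<longrightarrow>
        (\<exists>x \<in> S. graph_dist G u x \<noteq> graph_dist G w x))"

text \<open>Intended for finite graphs, where the set of all vertices is resolving, so that the minimum
  exists.\<close>

definition metric_dimension :: "('a, 'b) pre_digraph \<Rightarrow> nat" where
  "metric_dimension G = (LEAST m. \<exists>S. finite S \<and> resolving_set G S \<and> card S = m)"

end

theory Submission
  imports Defs
begin

text \<open>Vertices at distance 1 are the disjoint ones, so it suffices to find, for distinct \<open>k\<close>-sets
  \<open>U\<close>, \<open>W\<close> and a point \<open>w \<in> W - U\<close>, a block through \<open>w\<close> that misses \<open>U\<close>. Fix a
  \<open>(k - 2)\<close>-set \<open>R\<close> containing \<open>w\<close> and disjoint from \<open>U\<close>. The blocks containing \<open>R\<close> match up the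
  points outside \<open>R\<close> in pairs; if all of them met \<open>U\<close>, the points outside \<open>U \<union> R\<close> would be matched
  injectively into \<open>U\<close>, but there are more than \<open>k\<close> of them. The number of blocks is
  found by counting pairs of a \<open>(k - 1)\<close>-set and a block containing it.\<close>

lemma (in wf_digraph) awalk_cost_unit: "awalk_cost (\<lambda>_. 1) p = real (length p)"
  by (induction p) (simp_all)

text \<open>With unit weights the distance is an infimum of walk lengths, and only an arc is a walk
  of length 1. The conjunct \<open>u \<noteq> v\<close> excludes loops, since the empty walk gives a
  vertex distance 0 from itself.\<close>

lemma graph_dist_eq_1_iff:
  assumes "wf_digraph G"
  shows "graph_dist G u v = 1 \<longleftrightarrow> u \<noteq> v \<and> u \<rightarrow>\<^bsub>G\<^esub> v"
proof -
  interpret wf_digraph G by fact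
  have dist: "graph_dist G u v = (INF p \<in> {p. awalk u p v}. ereal (length p))"
    by (simp add: graph_dist_def \<mu>_def awalk_cost_unit)
  have upper: "graph_dist G u v \<le> ereal (length p)" if "awalk u p v" for p
    unfolding dist using that by (intro INF_lower) simp
  show ?thesis
  proof
    assume one: "graph_dist G u v = 1"
    have neq: "u \<noteq> v"
    proof
      assume "u = v"
      show False
      proof (cases "u \<in> verts G")
        case True
        then have "awalk u [] v" using \<open>u = v\<close> by (simp add: awalk_Nil_iff)
        from upper[OF this] one show False by simp
      next
        \<comment> \<open>Walks start at vertices, so here not even the empty walk exists and the
          infimum over the empty set is \<infinity>.\<close>
        case False
        then have "{p. awalk u p v} = {}" by (auto simp: awalk_def)
        with one show False by (simp add: dist top_ereal_def)
      qed
    qed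
    have "u \<rightarrow>\<^bsub>G\<^esub> v"
    proof (rule ccontr)
      assume nadj: "\<not> u \<rightarrow>\<^bsub>G\<^esub> v"
      have "2 \<le> length p" if walk: "awalk u p v" for p
      proof (rule ccontr)
        assume "\<not> 2 \<le> length p"
        then consider "p = []" | e where "p = [e]"
          by (cases p; cases "tl p") auto
        then show False
        proof cases
          case 1 with walk neq show False by (simp add: awalk_Nil_iff)
        next
          case (2 e)
          with walk have "e \<in> arcs G" "u = tail G e" "v = head G e"
            by (auto simp: awalk_Cons_iff awalk_Nil_iff)
          with nadj show False by (auto simp: arcs_ends_conv)
        qed
      qed
      then have "2 \<le> graph_dist G u v"
        unfolding dist by (intro INF_greatest) auto
      with one show False by simp
    qed
    with neq show "u \<noteq> v \<and> u \<rightarrow>\<^bsub>G\<^esub> v" by simp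
  next
    assume adj: "u \<noteq> v \<and> u \<rightarrow>\<^bsub>G\<^esub> v"
    then obtain e where "e \<in> arcs G" "tail G e = u" "head G e = v"
      by (auto simp: arcs_ends_conv)
    then have "awalk u [e] v" using arc_implies_awalk by fastforce
    from upper[OF this] have "graph_dist G u v \<le> 1" by (simp add: one_ereal_def)
    moreover have "1 \<le> length p" if "awalk u p v" for p
      using that adj by (cases p) (auto simp: awalk_Nil_iff)
    then have "1 \<le> graph_dist G u v"
      unfolding dist by (intro INF_greatest) auto
    ultimately show "graph_dist G u v = 1" by simp
  qed
qed

text \<open>For \<open>k \<ge> 1\<close> disjoint \<open>k\<close>-sets are nonempty and hence
  distinct, so adjacency alone decides whether the distance is 1.\<close>

lemma kneser_graph_dist_eq_1_iff:
  assumes "k \<ge> 1" "A \<in> k_subsets n k" "B \<in> k_subsets n k"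
  shows "graph_dist (kneser_graph n k) A B = 1 \<longleftrightarrow> A \<inter> B = {}"
proof -
  interpret pair_graph "kneser_graph n k"
    using assms(1) by (rule pair_graph_kneser_graph)
  have "A \<rightarrow>\<^bsub>with_proj (kneser_graph n k)\<^esub> B \<longleftrightarrow> A \<inter> B = {}"
    using assms by (simp add: arcs_ends_def arc_to_ends_def kneser_graph_def)
  moreover have "A \<noteq> {}" using assms by (auto simp: k_subsets_def)
  ultimately show ?thesis
    by (auto simp: graph_dist_eq_1_iff[OF wf_digraph])
qed

text \<open>The inequality \<open>large\<close> says exactly that the
  \<open>n - card U - (k - 2)\<close> points outside \<open>U\<close> and \<open>R\<close> outnumber
  \<open>U\<close>, which rules out an injection into \<open>U\<close>.\<close>

lemma steiner_block_through_point_disjoint: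
  assumes steiner: "steiner_system (k - 1) k n \<B>"
    and U: "U \<subseteq> {1..n}" and w: "w \<in> {1..n} - U"
    and large: "2 * card U + k < n + 2"
  obtains B where "B \<in> \<B>" "w \<in> B" "B \<inter> U = {}"
proof (rule ccontr)
  assume "\<not> thesis"
  with that have meets: "B \<inter> U \<noteq> {}" if "B \<in> \<B>" "w \<in> B" for B
    using that by blast
  have k3: "k \<ge> 3" and blocks: "\<B> \<subseteq> k_subsets n k"
    and ex1: "\<And>T. T \<in> k_subsets n (k - 1) \<Longrightarrow> \<exists>!B \<in> \<B>. T \<subseteq> B"
    using steiner by (auto simp: steiner_system_def)
  have finU: "finite U" using U finite_subset by blast
  have "card ({1..n} - U - {w}) = n - card U - 1"
    using U w by (simp add: card_Diff_subset finU)
  \<comment> \<open>Together with \<open>w\<close>, these \<open>k - 3\<close> points will form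
    \<open>R\<close>; for \<open>k = 3\<close> there are none and \<open>R\<close> is just
    \<open>{w}\<close>.\<close>
  then have "k - 3 \<le> card ({1..n} - U - {w})" using large k3 by linarith
  then obtain R' where R': "R' \<subseteq> {1..n} - U - {w}" "card R' = k - 3" "finite R'"
    by (rule obtain_subset_with_card_n)
  define R where "R = insert w R'"
  define D where "D = {1..n} - (U \<union> R)"
  have R: "R \<subseteq> {1..n} - U" "w \<in> R" "finite R"
    using R' w by (auto simp: R_def)
  have "w \<notin> R'" using R' by blast
  then have cardR: "card R = k - 2" using R' k3 by (simp add: R_def)
  have "card (U \<union> R) = card U + (k - 2)"
    using R finU cardR by (subst card_Un_disjoint) auto
  then have cardD: "card D = n - (card U + (k - 2))"
    unfolding D_def using R U finU by (subst card_Diff_subset) auto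
  \<comment> \<open>Used twice: for \<open>x \<in> D\<close> to get a block, and for the partner
    \<open>f x \<in> U\<close> to get its uniqueness.\<close>
  have ins: "insert x R \<in> k_subsets n (k - 1)" if "x \<in> {1..n} - R" for x
    using that R cardR k3 by (auto simp: k_subsets_def)
  \<comment> \<open>The block through \<open>insert x R\<close> contains \<open>w\<close>, so it
    meets \<open>U\<close>. As \<open>x\<close> and \<open>R\<close> avoid \<open>U\<close>, the
    common point is the one remaining element of the block.\<close>
  have "\<exists>u \<in> U. \<exists>B \<in> \<B>. B = insert u (insert x R)" if x: "x \<in> D" for x
  proof -
    from x have "x \<in> {1..n} - R" by (auto simp: D_def)
    from ex1[OF ins[OF this]] obtain B where B: "B \<in> \<B>" "insert x R \<subseteq> B" by blast
    with meets[of B] R obtain u where u: "u \<in> B" "u \<in> U" by blast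
    have "card B = k" "finite B"
      using blocks B(1) k3 card_ge_0_finite[of B] by (auto simp: k_subsets_def)
    moreover have "card (insert u (insert x R)) = k"
    proof -
      have "u \<notin> insert x R" "x \<notin> R" using u x R by (auto simp: D_def)
      then show ?thesis using R(3) cardR k3 by simp
    qed
    ultimately have "insert u (insert x R) = B"
      using B u by (intro card_subset_eq) auto
    with B u show ?thesis by blast
  qed
  then obtain f where f: "\<And>x. x \<in> D \<Longrightarrow> f x \<in> U"
      "\<And>x. x \<in> D \<Longrightarrow> insert (f x) (insert x R) \<in> \<B>"
    by metis
  have "inj_on f D"
  proof (rule inj_onI)
    fix x y assume xy: "x \<in> D" "y \<in> D" "f x = f y"
    \<comment> \<open>The blocks of \<open>x\<close> and \<open>y\<close> share the
      \<open>(k - 1)\<close>-set \<open>insert (f x) R\<close>, so they coincide, and each has only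
      one further point.\<close>
    have "f x \<in> {1..n} - R" using f(1)[OF xy(1)] U R by blast
    from ex1[OF ins[OF this]] f(2)[OF xy(1)] f(2)[OF xy(2)] xy(3)
    have "insert (f x) (insert x R) = insert (f x) (insert y R)" by (metis insert_mono subset_insertI)
    moreover have "y \<noteq> f x" "y \<notin> R" using xy f(1)[OF xy(1)] by (auto simp: D_def)
    ultimately show "x = y" by blast
  qed
  then have "card D \<le> card U" using f(1) finU by (intro card_inj_on_le) auto
  with cardD large k3 show False by linarith
qed

lemma steiner_system_card:
  assumes "steiner_system t k n \<B>"
  shows "(k choose t) * card \<B> = n choose t"
proof -
  have blocks: "\<B> \<subseteq> k_subsets n k"
    and ex1: "\<And>T. T \<in> k_subsets n t \<Longrightarrow> \<exists>!B \<in> \<B>. T \<subseteq> B"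
    using assms by (auto simp: steiner_system_def)
  have "card {T \<in> k_subsets n t. T \<subseteq> B} = k choose t" if "B \<in> \<B>" for B
  proof -
    have B: "B \<subseteq> {1..n}" "card B = k" using blocks that by (auto simp: k_subsets_def)
    then have "{T \<in> k_subsets n t. T \<subseteq> B} = {T. T \<subseteq> B \<and> card T = t}"
      by (auto simp: k_subsets_def)
    then show ?thesis using B n_subsets[of B t] finite_subset by fastforce
  qed
  \<comment> \<open>The incident pairs \<open>T \<subseteq> B\<close> are counted block by block
    here; counted by \<open>T\<close>, they contribute 1 each.\<close>
  then have "(\<Sum>T \<in> k_subsets n t. card {B \<in> \<B>. T \<subseteq> B}) = (k choose t) * card \<B>"
    using finite_k_subsets finite_subset[OF blocks] by (intro sum_multicount) auto
  moreover have "card {B \<in> \<B>. T \<subseteq> B} = 1" if "T \<in> k_subsets n t" for T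
  proof -
    from ex1[OF that] obtain B where "{B \<in> \<B>. T \<subseteq> B} = {B}" by blast
    then show ?thesis by simp
  qed
  ultimately have "(k choose t) * card \<B> = card (k_subsets n t)" by simp
  then show ?thesis using n_subsets[of "{1..n}" t] by (simp add: k_subsets_def)
qed

lemma metric_dimension_le_card:
  assumes "finite S" "resolving_set G S"
  shows "metric_dimension G \<le> card S"
  unfolding metric_dimension_def using assms by (intro Least_le) blast

theorem theorem4p5:
  fixes n k :: nat and \<B> :: "nat set set"
  assumes "k \<ge> 3"
    and "n \<ge> 4 * k - 2"
    and "steiner_system (k - 1) k n \<B>"
  shows "resolving_set (kneser_graph n k) \<B> \<and>
    real (metric_dimension (kneser_graph n k)) \<le> 1 / real k * real (n choose (k - 1))"
proof
  let ?K = "kneser_graph n k"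
  have blocks: "\<B> \<subseteq> k_subsets n k" using assms(3) by (simp add: steiner_system_def)
  have verts: "verts ?K = k_subsets n k" by (simp add: kneser_graph_def)
  show res: "resolving_set ?K \<B>"
    unfolding resolving_set_def verts
  proof (intro conjI ballI impI)
    show "\<B> \<subseteq> k_subsets n k" by (rule blocks)
  next
    fix U W assume U: "U \<in> k_subsets n k" and W: "W \<in> k_subsets n k" and "U \<noteq> W"
    have "finite U" "finite W" "card U = card W"
      using U W finite_subset by (auto simp: k_subsets_def)
    with \<open>U \<noteq> W\<close> have "\<not> W \<subseteq> U" by (metis card_subset_eq)
    then obtain w where "w \<in> W" "w \<notin> U" by blast
    with W have w: "w \<in> W" "w \<in> {1..n} - U" by (auto simp: k_subsets_def)
    \<comment> \<open>With \<open>card U = k\<close> the inequality reads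
      \<open>3 * k < n + 2\<close>, while \<open>n + 2 \<ge> 4 * k\<close>.\<close>
    have "U \<subseteq> {1..n}" "2 * card U + k < n + 2"
      using U assms(1,2) by (auto simp: k_subsets_def)
    then obtain B where B: "B \<in> \<B>" "w \<in> B" "B \<inter> U = {}"
      using steiner_block_through_point_disjoint[OF assms(3) _ w(2)] by blast
    have "B \<in> k_subsets n k" using B(1) blocks by blast
    moreover have "U \<inter> B = {}" "W \<inter> B \<noteq> {}" using B w(1) by auto
    ultimately have "graph_dist ?K U B = 1" "graph_dist ?K W B \<noteq> 1"
      using U W assms(1) by (simp_all add: kneser_graph_dist_eq_1_iff)
    with B(1) show "\<exists>X \<in> \<B>. graph_dist ?K U X \<noteq> graph_dist ?K W X" by metis
  qed
  have "finite \<B>" using blocks finite_k_subsets by (rule finite_subset)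
  then have "metric_dimension ?K \<le> card \<B>" using res by (rule metric_dimension_le_card)
  \<comment> \<open>The factor \<open>k\<close> is \<open>k choose (k - 1)\<close>, rewritten by
    symmetry to \<open>k choose 1\<close>.\<close>
  moreover have "k * card \<B> = n choose (k - 1)"
    using steiner_system_card[OF assms(3)] assms(1) binomial_symmetric[of "k - 1" k] by simp
  then have "real k * real (card \<B>) = real (n choose (k - 1))"
    by (metis of_nat_mult)
  then have "real (card \<B>) = 1 / real k * real (n choose (k - 1))"
    using assms(1) by (simp add: field_simps)
  ultimately show "real (metric_dimension ?K) \<le> 1 / real k * real (n choose (k - 1))"
    by linarith
qed

end
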